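(* Let $$A_1=S^{-1}\begin{bmatrix}0&I_r&0\\0&0&0\\0&0&0\end{bmatrix}S\in\mathbb{C}^{N_1\times N_1},$$ where $S$ is invertible and $r=\operatorname{rank}(A_1)$. Let $B_1,X_1\in\mathbb{C}^{N_1\times N_1}$ be conformally partitioned as $$B_1=S^{-1}\begin{bmatrix}B_{11}&B_{12}&B_{13}\\ B_{21}&B_{22}&B_{23}\\ B_{31}&B_{32}&B_{33}\end{bmatrix}S,\qquad X_1=S^{-1}\begin{bmatrix}X_{11}&X_{12}&X_{13}\\ X_{21}&X_{22}&X_{23}\\ X_{31}&X_{32}&X_{33}\end{bmatrix}S.$$ Define $M:=[\,X_{21}\;\;X_{22}\;\;X_{23}\,]$, $R_2:=[\,B_{21}\;\;B_{22}\;\;B_{23}\,]$, $R_3:=[\,B_{31}\;\;B_{32}\;\;B_{33}\,]$ and $R_1(X_{21}):=[\,-B_{11}\;\;X_{21}-B_{12}\;\;-B_{13}\,]$. Then the equation $$A_1X_1A_1-X_1A_1X_1=B_1$$ is consistent (for the unknown $X_1$) if and only if there exists a matrix $X_{21}$ such that $$X_{21}^2=-B_{21},$$ and, for this fixed choice of $X_{21}$, there exist matrices $X_{22},X_{23}$ satisfying $$X_{21}X_{22}=-B_{22},\qquad X_{21}X_{23}=-B_{23},$$ and the range conditions $$R_3=R_3M^-M,\qquad R_1(X_{21})=R_1(X_{21})M^-M$$ hold for some (equivalently, any) inner inverse $M^-$ of $M$. For each fixed admissible $X_{21}$, all solutions $X_1$ are obtained as follows: (i) Choose any $X_{21}$ satisfying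 $X_{21}^2=-B_{21}$. (ii) For any inner inverse $X_{21}^-$, $$X_{22}=-X_{21}^-B_{22}+(I-X_{21}^-X_{21})Z_{22},\qquad X_{23}=-X_{21}^-B_{23}+(I-X_{21}^-X_{21})Z_{23},$$ with arbitrary parameters $Z_{22},Z_{23}$, provided $X_{21}X_{21}^-B_{22}=B_{22}$ and $X_{21}X_{21}^-B_{23}=B_{23}$. (iii) For $X_{22},X_{23}$ for which the range conditions $R_3=R_3M^-M$ and $R_1(X_{21})=R_1(X_{21})M^-M$ hold and any inner inverse $M^-$ of $M$, $$X_{31}=-R_3M^-+Z_{31}(I-MM^-),\qquad X_{11}=R_1(X_{21})M^-+Z_{11}(I-MM^-),$$ with arbitrary parameters $Z_{31},Z_{11}$. (iv) The blocks $X_{12},X_{13},X_{32},X_{33}$ are arbitrary.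
   Context: All matrices are complex. An inner inverse of a matrix $L$ is any matrix $L^-$ with $LL^-L=L$. The parameters $Z_{ij}$ are matrices of appropriate dimensions. *)

theory Defs
  imports "Jordan_Normal_Form.Matrix" "Jordan_Normal_Form.DL_Rank"
begin

definition inner_inverse :: "complex mat \<Rightarrow> complex mat \<Rightarrow> bool" where
  "inner_inverse L G \<longleftrightarrow> G \<in> carrier_mat (dim_col L) (dim_row L) \<and> L * G * L = L"

(* The lower blocks have no rows, so this is the horizontal analogue of append_rows. *)
definition append_cols :: "complex mat \<Rightarrow> complex mat \<Rightarrow> complex mat"  (infixr "@\<^sub>c" 66) where
  "A @\<^sub>c B = four_block_mat A B (0\<^sub>m 0 (dim_col A)) (0\<^sub>m 0 (dim_col B))"

definition block33 ::
  "complex mat \<Rightarrow> complex mat \<Rightarrow> complex mat \<Rightarrow> complex mat \<Rightarrow> complex mat \<Rightarrow> complex mat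
    \<Rightarrow> complex mat \<Rightarrow> complex mat \<Rightarrow> complex mat \<Rightarrow> complex mat" where
  "block33 A11 A12 A13 A21 A22 A23 A31 A32 A33 =
     (A11 @\<^sub>c A12 @\<^sub>c A13) @\<^sub>r (A21 @\<^sub>c A22 @\<^sub>c A23) @\<^sub>r (A31 @\<^sub>c A32 @\<^sub>c A33)"

(* G stands for the inner inverse of M that is being used. *)
definition range_conditions ::
  "complex mat \<Rightarrow> complex mat \<Rightarrow> complex mat \<Rightarrow> complex mat \<Rightarrow> bool" where
  "range_conditions R1 R3 M G \<longleftrightarrow> R3 = R3 * G * M \<and> R1 = R1 * G * M"

(* R1 is the matrix-valued function of X21, not its value at X21. *)
definition admissible ::
  "nat \<Rightarrow> nat \<Rightarrow> complex mat \<Rightarrow> complex mat \<Rightarrow> complex mat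
    \<Rightarrow> (complex mat \<Rightarrow> complex mat) \<Rightarrow> complex mat \<Rightarrow> complex mat \<Rightarrow> bool" where
  "admissible r s B21 B22 B23 R1 R3 X21 \<longleftrightarrow>
     X21 \<in> carrier_mat r r \<and> X21 ^\<^sub>m 2 = - B21 \<and>
     (\<exists>X22 \<in> carrier_mat r r. \<exists>X23 \<in> carrier_mat r s.
        X21 * X22 = - B22 \<and> X21 * X23 = - B23 \<and>
        (\<exists>G. inner_inverse (X21 @\<^sub>c X22 @\<^sub>c X23) G \<and>
             range_conditions (R1 X21) R3 (X21 @\<^sub>c X22 @\<^sub>c X23) G))"

end

theory Submission
  imports Defs
begin

text \<open>
  In the given basis A1 becomes the block matrix J whose only nonzero block is an identity in
  position (1,2). It factors as J = E F, where right multiplication by E picks the first block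
  column of a matrix and left multiplication by F picks its second block row. With U the first
  block column of X and M = [X21 X22 X23] its second block row, this gives
  J X J = E (F X E) F = E X21 F and X J X = (X E) (F X) = U M. The only nonzero block row of J X J is
  its first one, namely [0 X21 0]. So the quadratic equation J X J - X J X = B splits along block rows into X11 M = R1(X21), X21 M = -R2 and X31 M = -R3
  (\<open>block33_equation_iff\<close>). The second of these involves only the second block row of X; it
  says X21 X21 = -B21, X21 X22 = -B22 and X21 X23 = -B23. Once X21, X22 and X23 are fixed, the
  other two are linear in X11 and X31. The blocks X12, X13, X32, X33 occur nowhere, so they are
  free.

  What remains is Penrose's description of the solutions of A X = C and X A = C by means of an inner
  inverse of A (\<open>left_equation_solutions\<close>, \<open>right_equation_solutions\<close>). The range
  condition C = C G A expresses that X A = C is solvable, a property in which G does not occur; this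
  is why the choice of the inner inverse is immaterial. Inner inverses always exist
  (\<open>inner_inverse_exists\<close>), which turns solvability into the existence of an inner inverse
  satisfying the range conditions.
\<close>

section \<open>Inner inverses and linear matrix equations\<close>

text \<open>
  The induction step in the construction of an inner inverse: A G fixes the columns of A with index
  below k, and a rank-one correction of G makes it fix column k too. If the residual
  d = a - A G a of that column a has a nonzero entry i, let w be row i of 1 - A G divided by d(i).
  Then w kills the columns that are already fixed and w a = 1. Since A (e_k - G a) = d, adding
  (e_k - G a) w to G changes A G by d w, which leaves the earlier columns alone and sends a to
  A G a + d = a.
\<close>

lemma extend_inner_inverse:
  fixes A G :: "complex mat"
  assumes A: "A \<in> carrier_mat m n" and G: "G \<in> carrier_mat n m" and k: "k < n"
    and fixed: "\<And>j. j < k \<Longrightarrow> (A * G) *\<^sub>v col A j = col A j"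
  shows "\<exists>G' \<in> carrier_mat n m. \<forall>j < Suc k. (A * G') *\<^sub>v col A j = col A j"
proof -
  define a where "a = col A k"
  define d where "d = a - (A * G) *\<^sub>v a"
  have a: "a \<in> carrier_vec m" and d: "d \<in> carrier_vec m" and AG: "A * G \<in> carrier_mat m m"
    using A G by (auto simp: a_def d_def intro!: minus_carrier_vec mult_mat_vec_carrier[of _ m m])
  have colA: "col A j \<in> carrier_vec m" for j
    using A by auto
  show ?thesis
  proof (cases "d = 0\<^sub>v m")
    case True
    have "(A * G) *\<^sub>v a = a"
    proof (rule eq_vecI)
      fix i assume "i < dim_vec a"
      then have i: "i < m" using a by auto
      have "d $ i = 0" using True i by simp
      then show "((A * G) *\<^sub>v a) $ i = a $ i"
        using i a AG unfolding d_def by auto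
    qed (use a AG in auto)
    then show ?thesis
      using G fixed by (auto simp: a_def less_Suc_eq)
  next
    case False
    then obtain i where i: "i < m" and di: "d $ i \<noteq> 0"
      using d by (metis carrier_vecD eq_vecI index_zero_vec)
    define w where "w = (1 / d $ i) \<cdot>\<^sub>v row (1\<^sub>m m - A * G) i"
    define u where "u = unit_vec n k - G *\<^sub>v a"
    define G' where "G' = G + mat n m (\<lambda>(p, q). u $ p * w $ q)"
    have w: "w \<in> carrier_vec m"
      unfolding w_def using A G by (intro carrier_vecI) simp
    have u: "u \<in> carrier_vec n"
      unfolding u_def using mult_mat_vec_carrier[OF G a] by (intro minus_carrier_vec) simp_all
    have G': "G' \<in> carrier_mat n m"
      unfolding G'_def using G by simp
    have wx: "w \<bullet> x = (x - (A * G) *\<^sub>v x) $ i / d $ i" if x: "x \<in> carrier_vec m" for x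
    proof -
      have "w \<bullet> x = (1 / d $ i) * (row (1\<^sub>m m - A * G) i \<bullet> x)"
        unfolding w_def using A G x by (intro smult_scalar_prod_distrib[of _ m] carrier_vecI) simp_all
      also have "row (1\<^sub>m m - A * G) i \<bullet> x = ((1\<^sub>m m - A * G) *\<^sub>v x) $ i"
        using i AG by (subst index_mult_mat_vec) auto
      also have "(1\<^sub>m m - A * G) *\<^sub>v x = x - (A * G) *\<^sub>v x"
        using x by (subst minus_mult_distrib_mat_vec[OF _ AG x]) auto
      finally show ?thesis by simp
    qed
    have outer: "mat n m (\<lambda>(p, q). u $ p * w $ q) *\<^sub>v x = (w \<bullet> x) \<cdot>\<^sub>v u"
      if x: "x \<in> carrier_vec m" for x
      using u w x
      by (intro eq_vecI) (auto simp: scalar_prod_def sum_distrib_left mult_ac)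
    have Au: "A *\<^sub>v u = d"
    proof -
      have "A *\<^sub>v u = A *\<^sub>v unit_vec n k - A *\<^sub>v (G *\<^sub>v a)"
        unfolding u_def using A G a by (intro mult_minus_distrib_mat_vec[of A m n]) auto
      moreover have "A *\<^sub>v unit_vec n k = a"
        unfolding a_def using A k by (intro eq_vecI) auto
      moreover have "A *\<^sub>v (G *\<^sub>v a) = (A * G) *\<^sub>v a"
        using A G a by simp
      ultimately show ?thesis by (simp add: d_def)
    qed
    have AG'x: "(A * G') *\<^sub>v x = (A * G) *\<^sub>v x + (w \<bullet> x) \<cdot>\<^sub>v d" if x: "x \<in> carrier_vec m" for x
    proof -
      have "G' *\<^sub>v x = G *\<^sub>v x + (w \<bullet> x) \<cdot>\<^sub>v u"
        unfolding G'_def outer[OF x, symmetric] using G x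
        by (intro add_mult_distrib_mat_vec[of G n m]) auto
      then have "A *\<^sub>v (G' *\<^sub>v x) = A *\<^sub>v (G *\<^sub>v x) + A *\<^sub>v ((w \<bullet> x) \<cdot>\<^sub>v u)"
        using A G x u by (simp add: mult_add_distrib_mat_vec[of A m n])
      then show ?thesis
        using A G G' x u by (simp add: mult_mat_vec[OF A u] Au)
    qed
    have "(A * G') *\<^sub>v col A j = col A j" if j: "j < Suc k" for j
    proof (cases "j = k")
      case True
      have "w \<bullet> a = 1" using wx[OF a] di by (simp add: d_def)
      then have "(A * G') *\<^sub>v a = (A * G) *\<^sub>v a + d" using AG'x[OF a] by simp
      also have "\<dots> = a" unfolding d_def using a AG by (intro eq_vecI) auto
      finally show ?thesis using True by (simp add: a_def)
    next
      case False
      then have eq: "(A * G) *\<^sub>v col A j = col A j" using fixed j by simp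
      have "w \<bullet> col A j = 0" using wx[OF colA[of j]] eq i A by simp
      moreover have "col A j + 0 \<cdot>\<^sub>v d = col A j"
        using A d by (intro eq_vecI) auto
      ultimately show ?thesis using AG'x[OF colA[of j]] eq by simp
    qed
    then show ?thesis using G' by blast
  qed
qed

lemma inner_inverse_exists:
  "\<exists>G. inner_inverse A G"
proof -
  define m n where "m = dim_row A" and "n = dim_col A"
  have A: "A \<in> carrier_mat m n" by (auto simp: m_def n_def)
  have "k \<le> n \<Longrightarrow> \<exists>G \<in> carrier_mat n m. \<forall>j < k. (A * G) *\<^sub>v col A j = col A j" for k
  proof (induction k)
    case 0
    show ?case by (intro bexI[of _ "0\<^sub>m n m"]) auto
  next
    case (Suc k)
    then obtain G where "G \<in> carrier_mat n m" "\<And>j. j < k \<Longrightarrow> (A * G) *\<^sub>v col A j = col A j"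
      by auto
    then show ?case using extend_inner_inverse[OF A] Suc.prems by simp
  qed
  then obtain G where G: "G \<in> carrier_mat n m"
    and cols: "\<And>j. j < n \<Longrightarrow> (A * G) *\<^sub>v col A j = col A j"
    by blast
  have "A * G * A = A"
  proof (rule mat_col_eqI)
    fix j assume "j < dim_col A"
    then have j: "j < n" by (simp add: n_def)
    have "col (A * G * A) j = (A * G) *\<^sub>v col A j"
      using A G j by (intro col_mult2[of _ m m _ n]) auto
    then show "col (A * G * A) j = col A j" using cols[OF j] by simp
  qed (use A G in auto)
  then show ?thesis using G unfolding inner_inverse_def m_def n_def by blast
qed

lemma inner_inverseD:
  assumes "inner_inverse A G" "A \<in> carrier_mat m n"
  shows "G \<in> carrier_mat n m" "A * G * A = A"
  using assms unfolding inner_inverse_def by auto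

text \<open>
  A solution X of X A = C gives C G A = X A G A = X A = C, and X = X A G + X (1 - A G) shows that X
  itself serves as the parameter Z. Conversely (1 - A G) A = 0, so the parameter does not
  contribute to X A.
\<close>

lemma right_equation_solutions:
  fixes A C G X :: "complex mat"
  assumes A: "A \<in> carrier_mat m n" and C: "C \<in> carrier_mat p n" and X: "X \<in> carrier_mat p m"
    and inv: "inner_inverse A G"
  shows "X * A = C \<longleftrightarrow>
    C = C * G * A \<and> (\<exists>Z \<in> carrier_mat p m. X = C * G + Z * (1\<^sub>m m - A * G))"
proof
  note G = inner_inverseD[OF inv A]
  have AG: "A * G \<in> carrier_mat m m" using A G by simp
  assume eq: "X * A = C"
  have "C * G * A = X * (A * G * A)"
    unfolding eq[symmetric] using X A G(1) AG
    by (simp add: assoc_mult_mat[of X p m A n] assoc_mult_mat[of X p m "A * G" m])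
  then have "C = C * G * A" using G(2) eq by simp
  moreover have "X = C * G + X * (1\<^sub>m m - A * G)"
  proof -
    have "X * (1\<^sub>m m - A * G) = X - C * G"
      using X A G(1) AG by (simp add: mult_minus_distrib_mat[OF X _ AG] eq[symmetric])
    moreover have "X = C * G + (X - C * G)"
      using X C G(1) by (intro eq_matI) auto
    ultimately show ?thesis by simp
  qed
  ultimately show "C = C * G * A \<and> (\<exists>Z \<in> carrier_mat p m. X = C * G + Z * (1\<^sub>m m - A * G))"
    using X by blast
next
  note G = inner_inverseD[OF inv A]
  have AG: "A * G \<in> carrier_mat m m" using A G by simp
  assume "C = C * G * A \<and> (\<exists>Z \<in> carrier_mat p m. X = C * G + Z * (1\<^sub>m m - A * G))"
  then obtain Z where CGA: "C = C * G * A" and Z: "Z \<in> carrier_mat p m"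
    and Xeq: "X = C * G + Z * (1\<^sub>m m - A * G)" by blast
  have "(1\<^sub>m m - A * G) * A = 0\<^sub>m m n"
    using A AG G(2) by (simp add: minus_mult_distrib_mat[OF _ AG A] minus_r_inv_mat[OF A])
  moreover have "Z * (1\<^sub>m m - A * G) * A = Z * ((1\<^sub>m m - A * G) * A)"
    using A AG Z by (intro assoc_mult_mat[of _ p m _ m _ n]) (auto intro: minus_carrier_mat)
  ultimately have "Z * (1\<^sub>m m - A * G) * A = 0\<^sub>m p n"
    using Z by simp
  moreover have "X * A = C * G * A + Z * (1\<^sub>m m - A * G) * A"
    unfolding Xeq using C G(1) Z AG A by (intro add_mult_distrib_mat[of _ p m]) auto
  ultimately show "X * A = C" using CGA C by simp
qed

lemma range_condition_iff_solvable:
  assumes A: "A \<in> carrier_mat m n" and C: "C \<in> carrier_mat p n" and inv: "inner_inverse A G"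
  shows "C = C * G * A \<longleftrightarrow> (\<exists>X \<in> carrier_mat p m. X * A = C)"
proof
  have "C * G \<in> carrier_mat p m" using C inner_inverseD(1)[OF inv A] by simp
  then show "C = C * G * A \<Longrightarrow> \<exists>X \<in> carrier_mat p m. X * A = C" by metis
next
  show "\<exists>X \<in> carrier_mat p m. X * A = C \<Longrightarrow> C = C * G * A"
    using right_equation_solutions[OF A C _ inv] by blast
qed

text \<open>The transpose of the preceding description, as the transpose of G is an inner inverse of
  the transpose of A.\<close>

lemma left_equation_solutions:
  fixes A C G X :: "complex mat"
  assumes A: "A \<in> carrier_mat m n" and C: "C \<in> carrier_mat m p" and X: "X \<in> carrier_mat n p"
    and inv: "inner_inverse A G"
  shows "A * X = C \<longleftrightarrow>
    C = A * G * C \<and> (\<exists>Z \<in> carrier_mat n p. X = G * C + (1\<^sub>m n - G * A) * Z)"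
proof -
  note G = inner_inverseD[OF inv A]
  have invT: "inner_inverse A\<^sup>T G\<^sup>T"
  proof -
    have "(A * G * A)\<^sup>T = A\<^sup>T * (G\<^sup>T * A\<^sup>T)"
      using A G(1) by (subst transpose_mult[of _ m m _ n]) (auto simp: transpose_mult[OF A G(1)])
    then show ?thesis
      unfolding inner_inverse_def using A G by (auto simp: assoc_mult_mat[of _ n m _ n _ m])
  qed
  have eqT: "A * X = C \<longleftrightarrow> X\<^sup>T * A\<^sup>T = C\<^sup>T"
    using A X by (metis transpose_mult transpose_transpose)
  have CT: "C = A * G * C \<longleftrightarrow> C\<^sup>T = C\<^sup>T * G\<^sup>T * A\<^sup>T"
  proof -
    have "(A * G * C)\<^sup>T = C\<^sup>T * (G\<^sup>T * A\<^sup>T)"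
      using A G(1) C by (subst transpose_mult[of _ m m _ p]) (auto simp: transpose_mult[OF A G(1)])
    moreover have "C\<^sup>T * (G\<^sup>T * A\<^sup>T) = C\<^sup>T * G\<^sup>T * A\<^sup>T"
      using A G(1) C by (intro assoc_mult_mat[symmetric, of _ p m _ n _ m]) auto
    ultimately show ?thesis by (metis transpose_transpose)
  qed
  have ZT: "X = G * C + (1\<^sub>m n - G * A) * Z \<longleftrightarrow>
      X\<^sup>T = C\<^sup>T * G\<^sup>T + Z\<^sup>T * (1\<^sub>m n - A\<^sup>T * G\<^sup>T)" if Z: "Z \<in> carrier_mat n p" for Z
  proof -
    have "(G * C + (1\<^sub>m n - G * A) * Z)\<^sup>T = C\<^sup>T * G\<^sup>T + Z\<^sup>T * (1\<^sub>m n - A\<^sup>T * G\<^sup>T)"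
    proof -
      have "(1\<^sub>m n - G * A)\<^sup>T = 1\<^sub>m n - A\<^sup>T * G\<^sup>T"
        using A G(1) by (subst transpose_minus[of _ n n]) (auto simp: transpose_mult[OF G(1) A])
      then have "((1\<^sub>m n - G * A) * Z)\<^sup>T = Z\<^sup>T * (1\<^sub>m n - A\<^sup>T * G\<^sup>T)"
        using A G(1) Z by (subst transpose_mult[of _ n n _ p]) (auto intro: minus_carrier_mat)
      then show ?thesis
        using A G(1) C Z
        by (subst transpose_add[of _ n p]) (auto simp: transpose_mult[OF G(1) C])
    qed
    then show ?thesis by (metis transpose_transpose)
  qed
  have "(\<exists>Z \<in> carrier_mat n p. X = G * C + (1\<^sub>m n - G * A) * Z) \<longleftrightarrow>
      (\<exists>Y \<in> carrier_mat p n. X\<^sup>T = C\<^sup>T * G\<^sup>T + Y * (1\<^sub>m n - A\<^sup>T * G\<^sup>T))"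
    using ZT by (metis transpose_carrier_mat transpose_transpose)
  then show ?thesis
    unfolding eqT CT using right_equation_solutions[of "A\<^sup>T" n m "C\<^sup>T" p "X\<^sup>T" "G\<^sup>T"] invT A C X by simp
qed

section \<open>Row and column blocks\<close>

lemma append_cols_carrier [simp, intro]:
  "A \<in> carrier_mat m n \<Longrightarrow> B \<in> carrier_mat m p \<Longrightarrow> A @\<^sub>c B \<in> carrier_mat m (n + p)"
  unfolding append_cols_def by auto

lemma append_cols_dim [simp]:
  "dim_row (A @\<^sub>c B) = dim_row A" "dim_col (A @\<^sub>c B) = dim_col A + dim_col B"
  by (simp_all add: append_cols_def)

lemma append_rows_dim [simp]:
  "dim_row (A @\<^sub>r B) = dim_row A + dim_row B" "dim_col (A @\<^sub>r B) = dim_col A"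
  by (simp_all add: append_rows_def)

lemma append_cols_index:
  assumes "A \<in> carrier_mat m n" "B \<in> carrier_mat m p" "i < m" "j < n + p"
  shows "(A @\<^sub>c B) $$ (i, j) = (if j < n then A $$ (i, j) else B $$ (i, j - n))"
  using assms unfolding append_cols_def by (subst index_mat_four_block) auto

lemma append_rows_index:
  assumes "A \<in> carrier_mat m n" "B \<in> carrier_mat p n" "i < m + p" "j < n"
  shows "(A @\<^sub>r B) $$ (i, j) = (if i < m then A $$ (i, j) else B $$ (i - m, j))"
  using assms unfolding append_rows_def by (subst index_mat_four_block) auto

lemma append_cols_eq_iff:
  assumes "A \<in> carrier_mat m n" "B \<in> carrier_mat m p"
    "A' \<in> carrier_mat m n" "B' \<in> carrier_mat m p"
  shows "A @\<^sub>c B = A' @\<^sub>c B' \<longleftrightarrow> A = A' \<and> B = B'"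
proof
  assume eq: "A @\<^sub>c B = A' @\<^sub>c B'"
  have "A $$ (i, j) = A' $$ (i, j)" if "i < m" "j < n" for i j
    using arg_cong[OF eq, of "\<lambda>M. M $$ (i, j)"] that assms by (simp add: append_cols_index)
  moreover have "B $$ (i, j) = B' $$ (i, j)" if "i < m" "j < p" for i j
    using arg_cong[OF eq, of "\<lambda>M. M $$ (i, n + j)"] that assms by (simp add: append_cols_index)
  ultimately show "A = A' \<and> B = B'" using assms by (auto intro!: eq_matI)
qed simp

lemma append_rows_eq_iff:
  assumes "A \<in> carrier_mat m n" "B \<in> carrier_mat p n"
    "A' \<in> carrier_mat m n" "B' \<in> carrier_mat p n"
  shows "A @\<^sub>r B = A' @\<^sub>r B' \<longleftrightarrow> A = A' \<and> B = B'"
proof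
  assume eq: "A @\<^sub>r B = A' @\<^sub>r B'"
  have "A $$ (i, j) = A' $$ (i, j)" if "i < m" "j < n" for i j
    using arg_cong[OF eq, of "\<lambda>M. M $$ (i, j)"] that assms by (simp add: append_rows_index)
  moreover have "B $$ (i, j) = B' $$ (i, j)" if "i < p" "j < n" for i j
    using arg_cong[OF eq, of "\<lambda>M. M $$ (m + i, j)"] that assms by (simp add: append_rows_index)
  ultimately show "A = A' \<and> B = B'" using assms by (auto intro!: eq_matI)
qed simp

lemma minus_append_cols:
  assumes "A \<in> carrier_mat m n" "B \<in> carrier_mat m p"
    "A' \<in> carrier_mat m n" "B' \<in> carrier_mat m p"
  shows "(A @\<^sub>c B) - (A' @\<^sub>c B') = (A - A') @\<^sub>c (B - B')"
proof (rule eq_matI)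
  fix i j assume "i < dim_row ((A - A') @\<^sub>c (B - B'))" "j < dim_col ((A - A') @\<^sub>c (B - B'))"
  then have ij: "i < m" "j < n + p"
    using assms by auto
  then show "((A @\<^sub>c B) - (A' @\<^sub>c B')) $$ (i, j) = ((A - A') @\<^sub>c (B - B')) $$ (i, j)"
    using append_cols_carrier[OF assms(1,2)] append_cols_carrier[OF assms(3,4)] assms
    by (subst append_cols_index[of "A - A'" m n "B - B'" p])
       (auto simp: append_cols_index[OF assms(1,2)] append_cols_index[OF assms(3,4)])
qed (use assms in \<open>auto simp: append_cols_def\<close>)

lemma minus_append_rows:
  fixes A A' B B' :: "'a :: ring mat"
  assumes "A \<in> carrier_mat m n" "B \<in> carrier_mat p n"
    "A' \<in> carrier_mat m n" "B' \<in> carrier_mat p n"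
  shows "(A @\<^sub>r B) - (A' @\<^sub>r B') = (A - A') @\<^sub>r (B - B')"
proof (rule eq_matI)
  fix i j assume "i < dim_row ((A - A') @\<^sub>r (B - B'))" "j < dim_col ((A - A') @\<^sub>r (B - B'))"
  then have ij: "i < m + p" "j < n"
    using assms by auto
  then show "((A @\<^sub>r B) - (A' @\<^sub>r B')) $$ (i, j) = ((A - A') @\<^sub>r (B - B')) $$ (i, j)"
    using carrier_append_rows[OF assms(1,2)] carrier_append_rows[OF assms(3,4)] assms
    by (subst append_rows_index[of "A - A'" m n "B - B'" p])
       (auto simp: append_rows_index[OF assms(1,2)] append_rows_index[OF assms(3,4)])
qed (use assms in \<open>auto simp: append_rows_def\<close>)

lemma uminus_append_cols:
  assumes "A \<in> carrier_mat m n" "B \<in> carrier_mat m p"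
  shows "- (A @\<^sub>c B) = (- A) @\<^sub>c (- B)"
proof (rule eq_matI)
  fix i j assume "i < dim_row ((- A) @\<^sub>c (- B))" "j < dim_col ((- A) @\<^sub>c (- B))"
  then have ij: "i < m" "j < n + p"
    using assms by auto
  then show "(- (A @\<^sub>c B)) $$ (i, j) = ((- A) @\<^sub>c (- B)) $$ (i, j)"
    using append_cols_carrier[OF assms(1,2)] assms
    by (subst append_cols_index[of "- A" m n "- B" p])
       (auto simp: append_cols_index[OF assms(1,2)])
qed (use assms in \<open>auto simp: append_cols_def\<close>)

lemma zero_append_cols: "0\<^sub>m m n @\<^sub>c 0\<^sub>m m p = 0\<^sub>m m (n + p)"
  by (auto simp: append_cols_def)

lemma mult_append_cols:
  assumes C: "C \<in> carrier_mat l m" and A: "A \<in> carrier_mat m n" and B: "B \<in> carrier_mat m p"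
  shows "C * (A @\<^sub>c B) = (C * A) @\<^sub>c (C * B)"
proof (rule eq_matI)
  fix i j assume "i < dim_row ((C * A) @\<^sub>c (C * B))" "j < dim_col ((C * A) @\<^sub>c (C * B))"
  then have ij: "i < l" "j < n + p"
    using assms by auto
  have "col (A @\<^sub>c B) j = (if j < n then col A j else col B (j - n))"
    using A B ij append_cols_carrier[OF A B]
    by (intro eq_vecI) (auto simp: append_cols_index[OF A B])
  then show "(C * (A @\<^sub>c B)) $$ (i, j) = ((C * A) @\<^sub>c (C * B)) $$ (i, j)"
    using ij assms append_cols_carrier[OF A B]
    by (subst append_cols_index[of "C * A" l n "C * B" p]) auto
qed (use assms in \<open>auto simp: append_cols_def\<close>)

lemma append_rows_mult:
  fixes A B C :: "'a :: semiring_0 mat"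
  assumes A: "A \<in> carrier_mat m n" and B: "B \<in> carrier_mat p n" and C: "C \<in> carrier_mat n l"
  shows "(A @\<^sub>r B) * C = (A * C) @\<^sub>r (B * C)"
proof (rule eq_matI)
  fix i j assume "i < dim_row ((A * C) @\<^sub>r (B * C))" "j < dim_col ((A * C) @\<^sub>r (B * C))"
  then have ij: "i < m + p" "j < l"
    using assms by auto
  have "row (A @\<^sub>r B) i = (if i < m then row A i else row B (i - m))"
    using A B ij carrier_append_rows[OF A B]
    by (intro eq_vecI) (auto simp: append_rows_index[OF A B])
  then show "((A @\<^sub>r B) * C) $$ (i, j) = ((A * C) @\<^sub>r (B * C)) $$ (i, j)"
    using ij assms carrier_append_rows[OF A B]
    by (subst append_rows_index[of "A * C" m l "B * C" p]) auto
qed (use assms in \<open>auto simp: append_rows_def\<close>)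

lemma append_cols_mult_append_rows:
  assumes "A \<in> carrier_mat m n" "B \<in> carrier_mat m p" "C \<in> carrier_mat n l" "D \<in> carrier_mat p l"
  shows "(A @\<^sub>c B) * (C @\<^sub>r D) = A * C + B * D"
proof -
  have "(A @\<^sub>c B) * (C @\<^sub>r D) = four_block_mat (A * C + B * D) (A * 0\<^sub>m n 0 + B * 0\<^sub>m p 0)
      (0\<^sub>m 0 n * C + 0\<^sub>m 0 p * D) (0\<^sub>m 0 n * 0\<^sub>m n 0 + 0\<^sub>m 0 p * 0\<^sub>m p 0)"
    unfolding append_cols_def append_rows_def using assms
    by (subst mult_four_block_mat[of _ m n _ p _ 0 _ _ l _ 0]) auto
  also have "\<dots> = A * C + B * D"
    using assms by (intro eq_matI) auto
  finally show ?thesis .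
qed

lemma append_cols_split:
  assumes "A \<in> carrier_mat m (n + p)"
  obtains B C where "B \<in> carrier_mat m n" "C \<in> carrier_mat m p" "A = B @\<^sub>c C"
proof
  define B where "B = mat m n (\<lambda>(i, j). A $$ (i, j))"
  define C where "C = mat m p (\<lambda>(i, j). A $$ (i, n + j))"
  show B: "B \<in> carrier_mat m n" and C: "C \<in> carrier_mat m p"
    by (auto simp: B_def C_def)
  show "A = B @\<^sub>c C"
    using assms B C by (intro eq_matI) (auto simp: append_cols_index[OF B C], auto simp: B_def C_def)
qed

lemma append_rows_split:
  assumes "A \<in> carrier_mat (m + p) n"
  obtains B C where "B \<in> carrier_mat m n" "C \<in> carrier_mat p n" "A = B @\<^sub>r C"
proof
  define B where "B = mat m n (\<lambda>(i, j). A $$ (i, j))"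
  define C where "C = mat p n (\<lambda>(i, j). A $$ (m + i, j))"
  show B: "B \<in> carrier_mat m n" and C: "C \<in> carrier_mat p n"
    by (auto simp: B_def C_def)
  show "A = B @\<^sub>r C"
    using assms B C by (intro eq_matI) (auto simp: append_rows_index[OF B C], auto simp: B_def C_def)
qed

section \<open>The equation in block form\<close>

lemma block33_carrier:
  assumes "X11 \<in> carrier_mat r r" "X12 \<in> carrier_mat r r" "X13 \<in> carrier_mat r s"
    "X21 \<in> carrier_mat r r" "X22 \<in> carrier_mat r r" "X23 \<in> carrier_mat r s"
    "X31 \<in> carrier_mat s r" "X32 \<in> carrier_mat s r" "X33 \<in> carrier_mat s s"
  shows "block33 X11 X12 X13 X21 X22 X23 X31 X32 X33 \<in> carrier_mat (r + r + s) (r + r + s)"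
  unfolding block33_def add.assoc using assms by (intro carrier_append_rows append_cols_carrier)

lemma block33_split:
  assumes "X \<in> carrier_mat (r + r + s) (r + r + s)"
  obtains X11 X12 X13 X21 X22 X23 X31 X32 X33 where
    "X11 \<in> carrier_mat r r" "X12 \<in> carrier_mat r r" "X13 \<in> carrier_mat r s"
    "X21 \<in> carrier_mat r r" "X22 \<in> carrier_mat r r" "X23 \<in> carrier_mat r s"
    "X31 \<in> carrier_mat s r" "X32 \<in> carrier_mat s r" "X33 \<in> carrier_mat s s"
    "X = block33 X11 X12 X13 X21 X22 X23 X31 X32 X33"
proof -
  have cols: "\<exists>A B C. A \<in> carrier_mat m r \<and> B \<in> carrier_mat m r \<and> C \<in> carrier_mat m s \<and>
      Y = A @\<^sub>c B @\<^sub>c C" if "Y \<in> carrier_mat m (r + (r + s))" for Y m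
    using that by (metis append_cols_split)
  from assms obtain Y1 Y' where 1: "Y1 \<in> carrier_mat r (r + (r + s))"
      "Y' \<in> carrier_mat (r + s) (r + (r + s))" "X = Y1 @\<^sub>r Y'"
    unfolding add.assoc by (rule append_rows_split)
  from 1(2) obtain Y2 Y3 where 2: "Y2 \<in> carrier_mat r (r + (r + s))"
      "Y3 \<in> carrier_mat s (r + (r + s))" "Y' = Y2 @\<^sub>r Y3"
    by (rule append_rows_split)
  show thesis
    using cols[OF 1(1)] cols[OF 2(1)] cols[OF 2(2)] 1(3) 2(3) that
    unfolding block33_def by metis
qed

text \<open>
  The factorization of J turns the quadratic term into the product of the first block column and
  the second block row of X, so the equation can be read off one block row at a time.
\<close>

lemma block33_equation_iff:
  assumes X: "X11 \<in> carrier_mat r r" "X12 \<in> carrier_mat r r" "X13 \<in> carrier_mat r s"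
      "X21 \<in> carrier_mat r r" "X22 \<in> carrier_mat r r" "X23 \<in> carrier_mat r s"
      "X31 \<in> carrier_mat s r" "X32 \<in> carrier_mat s r" "X33 \<in> carrier_mat s s"
    and B: "B11 \<in> carrier_mat r r" "B12 \<in> carrier_mat r r" "B13 \<in> carrier_mat r s"
      "B21 \<in> carrier_mat r r" "B22 \<in> carrier_mat r r" "B23 \<in> carrier_mat r s"
      "B31 \<in> carrier_mat s r" "B32 \<in> carrier_mat s r" "B33 \<in> carrier_mat s s"
  defines "J \<equiv> block33 (0\<^sub>m r r) (1\<^sub>m r) (0\<^sub>m r s)
                       (0\<^sub>m r r) (0\<^sub>m r r) (0\<^sub>m r s)
                       (0\<^sub>m s r) (0\<^sub>m s r) (0\<^sub>m s s)"
    and "X \<equiv> block33 X11 X12 X13 X21 X22 X23 X31 X32 X33"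
    and "M \<equiv> X21 @\<^sub>c X22 @\<^sub>c X23"
  shows "J * X * J - X * J * X = block33 B11 B12 B13 B21 B22 B23 B31 B32 B33 \<longleftrightarrow>
    X11 * M = (- B11) @\<^sub>c (X21 - B12) @\<^sub>c (- B13) \<and>
    X21 * X21 = - B21 \<and> X21 * X22 = - B22 \<and> X21 * X23 = - B23 \<and>
    X31 * M = - (B31 @\<^sub>c B32 @\<^sub>c B33)"
proof -
  let ?n = "r + (r + s)"
  define E where "E = (1\<^sub>m r :: complex mat) @\<^sub>r 0\<^sub>m r r @\<^sub>r 0\<^sub>m s r"
  define F where "F = (0\<^sub>m r r :: complex mat) @\<^sub>c 1\<^sub>m r @\<^sub>c 0\<^sub>m r s"
  define U where "U = X11 @\<^sub>r X21 @\<^sub>r X31"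
  have E: "E \<in> carrier_mat ?n r" and F: "F \<in> carrier_mat r ?n" and U: "U \<in> carrier_mat ?n r"
    and M: "M \<in> carrier_mat r ?n"
    unfolding E_def F_def U_def M_def using X by auto
  have Xc: "X \<in> carrier_mat ?n ?n"
    using block33_carrier[OF X] by (simp add: X_def add.assoc)
  have rows_mult: "(P @\<^sub>r Q @\<^sub>r R) * Y = P * Y @\<^sub>r Q * Y @\<^sub>r R * Y"
    if "P \<in> carrier_mat r k" "Q \<in> carrier_mat r k" "R \<in> carrier_mat s k" "Y \<in> carrier_mat k l"
    for P Q R Y :: "complex mat" and k l
    using that by (simp add: append_rows_mult[of _ r k _ "r + s" _ l]
        append_rows_mult[of _ r k _ s _ l])
  \<comment> \<open>E and F are the inclusion of the first block and the projection to the second one; U is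
    the first block column of X.\<close>
  have J: "J = E * F"
    unfolding E_def rows_mult[OF one_carrier_mat zero_carrier_mat zero_carrier_mat F]
    using F by (simp add: J_def block33_def F_def zero_append_cols)
  have rowE: "(P @\<^sub>c Q @\<^sub>c R) * E = P"
    if "P \<in> carrier_mat m r" "Q \<in> carrier_mat m r" "R \<in> carrier_mat m s"
    for P Q R :: "complex mat" and m
    unfolding E_def using that
    by (simp add: append_cols_mult_append_rows[of _ m r _ "r + s" _ r]
        append_cols_mult_append_rows[of _ m r _ s _ r])
  have XE: "X * E = U"
  proof -
    have "X * E = (X11 @\<^sub>c X12 @\<^sub>c X13) * E @\<^sub>r (X21 @\<^sub>c X22 @\<^sub>c X23) * E @\<^sub>r (X31 @\<^sub>c X32 @\<^sub>c X33) * E"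
      unfolding X_def block33_def
      by (rule rows_mult[of _ ?n _ _ _ r]) (use X E in auto)
    then show ?thesis using X by (simp add: rowE U_def)
  qed
  have FX: "F * X = M"
  proof -
    have carrier: "X11 @\<^sub>c X12 @\<^sub>c X13 \<in> carrier_mat r ?n" "X31 @\<^sub>c X32 @\<^sub>c X33 \<in> carrier_mat s ?n"
      using X by auto
    then show ?thesis
      unfolding F_def X_def block33_def M_def[symmetric] using M
      by (simp add: left_mult_zero_mat[OF carrier(1)] left_mult_zero_mat[OF carrier(2)] append_cols_mult_append_rows[of _ r r _ "r + s" _ ?n]
          append_cols_mult_append_rows[of _ r r _ s _ ?n])
  qed
  have "J * X = E * M"
    unfolding J FX[symmetric] by (rule assoc_mult_mat[OF E F Xc])
  moreover have "M * E = X21"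
    unfolding M_def using X by (intro rowE)
  ultimately have JXJ: "J * X * J = E * (X21 * F)"
    using assoc_mult_mat[OF E M, of "E * F" ?n] assoc_mult_mat[OF M E F] E F
    by (simp add: J)
  have "X * J = U * F"
    unfolding J XE[symmetric] by (rule assoc_mult_mat[OF Xc E F, symmetric])
  then have XJX: "X * J * X = U * M"
    using assoc_mult_mat[OF U F Xc] by (simp add: FX)
  have X21F: "X21 * F = 0\<^sub>m r r @\<^sub>c X21 @\<^sub>c 0\<^sub>m r s"
    unfolding F_def using X
    by (simp add: mult_append_cols[of _ r r _ r _ "r + s"] mult_append_cols[of _ r r _ r _ s])
  have EX: "E * (X21 * F) = X21 * F @\<^sub>r 0\<^sub>m r ?n @\<^sub>r 0\<^sub>m s ?n"
    unfolding E_def using X F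
    by (subst rows_mult[of _ r _ _ _ ?n]) (auto intro: left_mult_zero_mat)
  have UM: "U * M = X11 * M @\<^sub>r X21 * M @\<^sub>r X31 * M"
    unfolding U_def using X M by (intro rows_mult[of _ r _ _ _ ?n])
  let ?R1 = "B11 @\<^sub>c B12 @\<^sub>c B13" and ?R2 = "B21 @\<^sub>c B22 @\<^sub>c B23" and ?R3 = "B31 @\<^sub>c B32 @\<^sub>c B33"
  have R: "?R1 \<in> carrier_mat r ?n" "?R2 \<in> carrier_mat r ?n" "?R3 \<in> carrier_mat s ?n"
    using B by auto
  have XM: "X11 * M \<in> carrier_mat r ?n" "X21 * M \<in> carrier_mat r ?n" "X31 * M \<in> carrier_mat s ?n"
    "X21 * F \<in> carrier_mat r ?n"
    using X M F by auto
  have "J * X * J - X * J * X =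
      (X21 * F - X11 * M) @\<^sub>r (0\<^sub>m r ?n - X21 * M) @\<^sub>r (0\<^sub>m s ?n - X31 * M)"
    unfolding JXJ XJX EX UM using XM
    by (simp add: minus_append_rows[of _ r ?n _ "r + s"] minus_append_rows[of _ r ?n _ s])
  moreover have "X21 * F - X11 * M \<in> carrier_mat r ?n" "0\<^sub>m r ?n - X21 * M \<in> carrier_mat r ?n"
    "0\<^sub>m s ?n - X31 * M \<in> carrier_mat s ?n"
    using XM by (auto intro: minus_carrier_mat)
  ultimately have eq: "J * X * J - X * J * X = block33 B11 B12 B13 B21 B22 B23 B31 B32 B33 \<longleftrightarrow>
      X21 * F - X11 * M = ?R1 \<and> 0\<^sub>m r ?n - X21 * M = ?R2 \<and> 0\<^sub>m s ?n - X31 * M = ?R3"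
    unfolding block33_def using R
    by (simp add: append_rows_eq_iff[of _ r ?n _ "r + s"] append_rows_eq_iff[of _ r ?n _ s])
  have minus_eq: "P - Q = C \<longleftrightarrow> Q = P - C"
    if "P \<in> carrier_mat m k" "Q \<in> carrier_mat m k" "C \<in> carrier_mat m k"
    for P Q C :: "complex mat" and m k
  proof -
    have flip: "P - (P - D) = D" if "D \<in> carrier_mat m k" for D
      using that \<open>P \<in> carrier_mat m k\<close> by (intro eq_matI) auto
    show ?thesis using flip[OF that(2)] flip[OF that(3)] by auto
  qed
  have zero_minus: "0\<^sub>m m k - C = - C" if "C \<in> carrier_mat m k" for C :: "complex mat" and m k
    using that by (intro eq_matI) auto
  have row1: "X21 * F - ?R1 = (- B11) @\<^sub>c (X21 - B12) @\<^sub>c (- B13)"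
    unfolding X21F using X B
    by (simp add: minus_append_cols[of _ r r _ "r + s"] minus_append_cols[of _ r r _ s] zero_minus)
  have row2: "X21 * M = 0\<^sub>m r ?n - ?R2 \<longleftrightarrow>
      X21 * X21 = - B21 \<and> X21 * X22 = - B22 \<and> X21 * X23 = - B23"
  proof -
    have "X22 @\<^sub>c X23 \<in> carrier_mat r (r + s)" "B22 @\<^sub>c B23 \<in> carrier_mat r (r + s)"
      using X B by auto
    then have "X21 * M = X21 * X21 @\<^sub>c X21 * X22 @\<^sub>c X21 * X23"
      and "- ?R2 = (- B21) @\<^sub>c (- B22) @\<^sub>c (- B23)"
      unfolding M_def using X B
      by (simp_all only: mult_append_cols[of X21 r r] uminus_append_cols[of _ r r])
    then show ?thesis
      unfolding zero_minus[OF R(2)] using X B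
      by (simp only: append_cols_eq_iff[of _ r r _ "r + s"] append_cols_eq_iff[of _ r r _ s]
          mult_carrier_mat[of _ r r] uminus_carrier_iff_mat append_cols_carrier)
  qed
  have row3: "0\<^sub>m s ?n - ?R3 = - ?R3"
    by (rule zero_minus[OF R(3)])
  show ?thesis
    unfolding eq minus_eq[OF XM(4,1) R(1)] minus_eq[OF zero_carrier_mat XM(2) R(2)]
      minus_eq[OF zero_carrier_mat XM(3) R(3)] row1 row2 row3
    by (simp only: conj_assoc)
qed

section \<open>Change of basis\<close>

lemma conjugated_equation_iff:
  fixes S Sinv J X B :: "complex mat"
  assumes S: "S \<in> carrier_mat n n" "Sinv \<in> carrier_mat n n" "S * Sinv = 1\<^sub>m n"
    and JXB: "J \<in> carrier_mat n n" "X \<in> carrier_mat n n" "B \<in> carrier_mat n n"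
  shows "(Sinv * J * S) * (Sinv * X * S) * (Sinv * J * S)
      - (Sinv * X * S) * (Sinv * J * S) * (Sinv * X * S) = Sinv * B * S \<longleftrightarrow>
    J * X * J - X * J * X = B"
proof -
  have cancel: "S * (Sinv * D) = D" if "D \<in> carrier_mat n n" for D
    using assoc_mult_mat[OF S(1,2) that] S(3) that by simp
  have mult: "(Sinv * P * S) * (Sinv * Q * S) = Sinv * (P * Q) * S"
    if "P \<in> carrier_mat n n" "Q \<in> carrier_mat n n" for P Q
    using S(1,2) that by (simp add: assoc_mult_mat[of _ n n _ n _ n] cancel)
  have minus: "Sinv * P * S - Sinv * Q * S = Sinv * (P - Q) * S"
    if "P \<in> carrier_mat n n" "Q \<in> carrier_mat n n" for P Q
    using S(1,2) that
    by (simp add: mult_minus_distrib_mat[of _ n n _ n] minus_mult_distrib_mat[of _ n n _ _ n])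
  have inj: "Sinv * P * S = Sinv * Q * S \<longleftrightarrow> P = Q"
    if "P \<in> carrier_mat n n" "Q \<in> carrier_mat n n" for P Q
  proof -
    have recover: "S * (Sinv * D * S) * Sinv = D" if D: "D \<in> carrier_mat n n" for D
      using S D by (simp add: assoc_mult_mat[of _ n n _ n _ n] cancel)
    show ?thesis using recover that by metis
  qed
  have "J * X * J \<in> carrier_mat n n" "X * J * X \<in> carrier_mat n n"
    "J * X * J - X * J * X \<in> carrier_mat n n"
    using JXB by (auto intro!: minus_carrier_mat)
  then show ?thesis
    using JXB by (simp only: mult minus inj mult_carrier_mat[of _ n n _ n])
qed

section \<open>Solutions of the equation\<close>

theorem theorem3p3:
  fixes r s N :: nat
    and S Sinv A1 B1 B11 B12 B13 B21 B22 B23 B31 B32 B33 R3 :: "complex mat"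
    and R1 :: "complex mat \<Rightarrow> complex mat"
    and solution :: "complex mat \<Rightarrow> bool"
  assumes N: "N = r + r + s"
    and S: "S \<in> carrier_mat N N" "Sinv \<in> carrier_mat N N"
      "inverts_mat S Sinv" "inverts_mat Sinv S"
    and A1: "A1 = Sinv * block33 (0\<^sub>m r r) (1\<^sub>m r) (0\<^sub>m r s)
                                 (0\<^sub>m r r) (0\<^sub>m r r) (0\<^sub>m r s)
                                 (0\<^sub>m s r) (0\<^sub>m s r) (0\<^sub>m s s) * S"
    and rank: "r = vec_space.rank N A1"
    and B: "B11 \<in> carrier_mat r r" "B12 \<in> carrier_mat r r" "B13 \<in> carrier_mat r s"
           "B21 \<in> carrier_mat r r" "B22 \<in> carrier_mat r r" "B23 \<in> carrier_mat r s"
           "B31 \<in> carrier_mat s r" "B32 \<in> carrier_mat s r" "B33 \<in> carrier_mat s s"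
    and B1: "B1 = Sinv * block33 B11 B12 B13 B21 B22 B23 B31 B32 B33 * S"
    and R3: "R3 = B31 @\<^sub>c B32 @\<^sub>c B33"
    and R1: "\<And>Y. R1 Y = (- B11) @\<^sub>c (Y - B12) @\<^sub>c (- B13)"
    and solution: "\<And>X1. solution X1 \<longleftrightarrow>
          X1 \<in> carrier_mat N N \<and> A1 * X1 * A1 - X1 * A1 * X1 = B1"
  (* in order: consistency criterion; independence of the range conditions from the inner inverse;
     admissibility of the (2,1) block of every solution; all solutions with a fixed admissible
     (2,1) block, for any inner inverse of that block and any selection Minv of inner inverses *)
  shows
    "((\<exists>X1. solution X1) \<longleftrightarrow> (\<exists>X21. admissible r s B21 B22 B23 R1 R3 X21)) \<and>
     (\<forall>X21 \<in> carrier_mat r r. \<forall>X22 \<in> carrier_mat r r. \<forall>X23 \<in> carrier_mat r s.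
           let M = X21 @\<^sub>c X22 @\<^sub>c X23 in
             (\<exists>G. inner_inverse M G \<and> range_conditions (R1 X21) R3 M G) \<longleftrightarrow>
             (\<forall>G. inner_inverse M G \<longrightarrow> range_conditions (R1 X21) R3 M G)) \<and>
     (\<forall>X11 \<in> carrier_mat r r. \<forall>X12 \<in> carrier_mat r r. \<forall>X13 \<in> carrier_mat r s.
         \<forall>X21 \<in> carrier_mat r r. \<forall>X22 \<in> carrier_mat r r. \<forall>X23 \<in> carrier_mat r s.
         \<forall>X31 \<in> carrier_mat s r. \<forall>X32 \<in> carrier_mat s r. \<forall>X33 \<in> carrier_mat s s.
           solution (Sinv * block33 X11 X12 X13 X21 X22 X23 X31 X32 X33 * S) \<longrightarrow>
           admissible r s B21 B22 B23 R1 R3 X21) \<and>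
     (\<forall>X21 X21inv Minv.
         admissible r s B21 B22 B23 R1 R3 X21 \<and> inner_inverse X21 X21inv \<and>
         (\<forall>M \<in> carrier_mat r N. inner_inverse M (Minv M)) \<longrightarrow>
         {X1. solution X1 \<and>
            (\<exists>X11 \<in> carrier_mat r r. \<exists>X12 \<in> carrier_mat r r. \<exists>X13 \<in> carrier_mat r s.
             \<exists>X22 \<in> carrier_mat r r. \<exists>X23 \<in> carrier_mat r s.
             \<exists>X31 \<in> carrier_mat s r. \<exists>X32 \<in> carrier_mat s r. \<exists>X33 \<in> carrier_mat s s.
               X1 = Sinv * block33 X11 X12 X13 X21 X22 X23 X31 X32 X33 * S)} =
         {Sinv * block33 X11 X12 X13 X21 X22 X23 X31 X32 X33 * S |
            X11 X12 X13 X22 X23 X31 X32 X33 Z22 Z23 Z31 Z11 M.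
            Z22 \<in> carrier_mat r r \<and> Z23 \<in> carrier_mat r s \<and>
            Z31 \<in> carrier_mat s r \<and> Z11 \<in> carrier_mat r r \<and>
            X21 * X21inv * B22 = B22 \<and> X21 * X21inv * B23 = B23 \<and>
            X22 = - X21inv * B22 + (1\<^sub>m r - X21inv * X21) * Z22 \<and>
            X23 = - X21inv * B23 + (1\<^sub>m r - X21inv * X21) * Z23 \<and>
            M = X21 @\<^sub>c X22 @\<^sub>c X23 \<and>
            range_conditions (R1 X21) R3 M (Minv M) \<and>
            X31 = - R3 * Minv M + Z31 * (1\<^sub>m r - M * Minv M) \<and>
            X11 = R1 X21 * Minv M + Z11 * (1\<^sub>m r - M * Minv M) \<and>
            X12 \<in> carrier_mat r r \<and> X13 \<in> carrier_mat r s \<and>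
            X32 \<in> carrier_mat s r \<and> X33 \<in> carrier_mat s s})"
proof -
  let ?E = "\<lambda>X11 X12 X13 X21 X22 X23 X31 X32 X33.
    Sinv * block33 X11 X12 X13 X21 X22 X23 X31 X32 X33 * S"
  have SS: "S * Sinv = 1\<^sub>m N" "Sinv * S = 1\<^sub>m N"
    using S by (auto simp: inverts_mat_def)
  have R3c: "R3 \<in> carrier_mat s N"
    unfolding R3 N add.assoc using B by auto
  have R1c: "R1 Y \<in> carrier_mat r N" if "Y \<in> carrier_mat r r" for Y
    unfolding R1 N add.assoc using B that
    by (intro append_cols_carrier) (auto intro: minus_carrier_mat)
  have Mc: "X21 @\<^sub>c X22 @\<^sub>c X23 \<in> carrier_mat r N"
    if "X21 \<in> carrier_mat r r" "X22 \<in> carrier_mat r r" "X23 \<in> carrier_mat r s" for X21 X22 X23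
    unfolding N add.assoc using that by auto
  have sol: "solution (?E X11 X12 X13 X21 X22 X23 X31 X32 X33) \<longleftrightarrow>
      X11 * (X21 @\<^sub>c X22 @\<^sub>c X23) = R1 X21 \<and>
      X21 * X21 = - B21 \<and> X21 * X22 = - B22 \<and> X21 * X23 = - B23 \<and>
      X31 * (X21 @\<^sub>c X22 @\<^sub>c X23) = - R3"
    if X: "X11 \<in> carrier_mat r r" "X12 \<in> carrier_mat r r" "X13 \<in> carrier_mat r s"
      "X21 \<in> carrier_mat r r" "X22 \<in> carrier_mat r r" "X23 \<in> carrier_mat r s"
      "X31 \<in> carrier_mat s r" "X32 \<in> carrier_mat s r" "X33 \<in> carrier_mat s s"
    for X11 X12 X13 X21 X22 X23 X31 X32 X33
  proof -
    have X1: "?E X11 X12 X13 X21 X22 X23 X31 X32 X33 \<in> carrier_mat N N"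
      using block33_carrier[OF X] S(1,2) unfolding N[symmetric]
      by (intro mult_carrier_mat[of _ N N])
    have J: "block33 (0\<^sub>m r r) (1\<^sub>m r) (0\<^sub>m r s) (0\<^sub>m r r) (0\<^sub>m r r) (0\<^sub>m r s)
        (0\<^sub>m s r) (0\<^sub>m s r) (0\<^sub>m s s) \<in> carrier_mat N N"
      unfolding N by (intro block33_carrier) simp_all
    show ?thesis
      unfolding solution A1 B1 R1 R3 block33_equation_iff[OF X B, symmetric]
        conjugated_equation_iff[OF S(1,2) SS(1) J block33_carrier[OF X, folded N]
          block33_carrier[OF B, folded N]]
      using X1 by simp
  qed
  \<comment> \<open>The equation to be solved is X31 M = -R3, whereas the range condition is stated for R3.\<close>
  have negated_R3: "- R3 = - R3 * G * M \<longleftrightarrow> R3 = R3 * G * M"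
    if "M \<in> carrier_mat r N" "inner_inverse M G" for M G
    using R3c that(1) inner_inverseD(1)[OF that(2,1)] by simp
  \<comment> \<open>Range conditions are solvability conditions for X11 and X31, so admissibility of X21 says that
    the system for the other four blocks that occur in it has a solution.\<close>
  have adm: "admissible r s B21 B22 B23 R1 R3 X21 \<longleftrightarrow>
      (\<exists>X22 \<in> carrier_mat r r. \<exists>X23 \<in> carrier_mat r s.
       \<exists>X11 \<in> carrier_mat r r. \<exists>X31 \<in> carrier_mat s r.
         X11 * (X21 @\<^sub>c X22 @\<^sub>c X23) = R1 X21 \<and>
         X21 * X21 = - B21 \<and> X21 * X22 = - B22 \<and> X21 * X23 = - B23 \<and>
         X31 * (X21 @\<^sub>c X22 @\<^sub>c X23) = - R3)"
    if X21: "X21 \<in> carrier_mat r r" for X21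
  proof -
    have "(\<exists>G. inner_inverse M G \<and> range_conditions (R1 X21) R3 M G) \<longleftrightarrow>
        (\<exists>X11 \<in> carrier_mat r r. X11 * M = R1 X21) \<and> (\<exists>X31 \<in> carrier_mat s r. X31 * M = - R3)"
      if M: "M \<in> carrier_mat r N" for M
    proof -
      have R3': "- R3 \<in> carrier_mat s N" using R3c by simp
      have "range_conditions (R1 X21) R3 M G \<longleftrightarrow>
          (\<exists>X11 \<in> carrier_mat r r. X11 * M = R1 X21) \<and> (\<exists>X31 \<in> carrier_mat s r. X31 * M = - R3)"
        if "inner_inverse M G" for G
        using range_condition_iff_solvable[OF M R1c[OF X21] that]
          range_condition_iff_solvable[OF M R3' that] negated_R3[OF M that]
        unfolding range_conditions_def by auto
      then show ?thesis using inner_inverse_exists[of M] by blast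
    qed
    note range = this[OF Mc[OF X21]]
    have "X21 ^\<^sub>m 2 = X21 * X21"
      using X21 by (simp add: numeral_2_eq_2)
    then show ?thesis
      unfolding admissible_def using X21 range by auto
  qed
  have adm_of_solution: "admissible r s B21 B22 B23 R1 R3 X21"
    if X: "X11 \<in> carrier_mat r r" "X12 \<in> carrier_mat r r" "X13 \<in> carrier_mat r s"
      "X21 \<in> carrier_mat r r" "X22 \<in> carrier_mat r r" "X23 \<in> carrier_mat r s"
      "X31 \<in> carrier_mat s r" "X32 \<in> carrier_mat s r" "X33 \<in> carrier_mat s s"
      and "solution (?E X11 X12 X13 X21 X22 X23 X31 X32 X33)"
    for X11 X12 X13 X21 X22 X23 X31 X32 X33
    using that sol[OF X] adm[OF X(4)] by blast
  have consistency: "(\<exists>X1. solution X1) \<longleftrightarrow> (\<exists>X21. admissible r s B21 B22 B23 R1 R3 X21)"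
  proof
    assume "\<exists>X1. solution X1"
    then obtain X1 where X1: "solution X1" "X1 \<in> carrier_mat N N"
      by (auto simp: solution)
    have "S * X1 * Sinv \<in> carrier_mat (r + r + s) (r + r + s)"
      using S(1,2) X1(2) unfolding N[symmetric] by (intro mult_carrier_mat[of _ N N])
    then obtain X11 X12 X13 X21 X22 X23 X31 X32 X33 where
      X: "X11 \<in> carrier_mat r r" "X12 \<in> carrier_mat r r" "X13 \<in> carrier_mat r s"
      "X21 \<in> carrier_mat r r" "X22 \<in> carrier_mat r r" "X23 \<in> carrier_mat r s"
      "X31 \<in> carrier_mat s r" "X32 \<in> carrier_mat s r" "X33 \<in> carrier_mat s s"
      and eq: "S * X1 * Sinv = block33 X11 X12 X13 X21 X22 X23 X31 X32 X33"
      by (rule block33_split)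
    have cancel: "Sinv * (S * D) = D" if "D \<in> carrier_mat N N" for D
      using assoc_mult_mat[OF S(2,1) that] SS(2) that by simp
    have "Sinv * (S * X1 * Sinv) * S = X1"
      using S(1,2) SS(2) X1(2) by (simp add: assoc_mult_mat[of _ N N _ N _ N] cancel)
    then show "\<exists>X21. admissible r s B21 B22 B23 R1 R3 X21"
      using adm_of_solution[OF X] X1(1) eq by auto
  next
    assume "\<exists>X21. admissible r s B21 B22 B23 R1 R3 X21"
    then obtain X21 where X21: "admissible r s B21 B22 B23 R1 R3 X21" "X21 \<in> carrier_mat r r"
      by (auto simp: admissible_def)
    then obtain X22 X23 X11 X31 where "X22 \<in> carrier_mat r r" "X23 \<in> carrier_mat r s"
      "X11 \<in> carrier_mat r r" "X31 \<in> carrier_mat s r"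
      "X11 * (X21 @\<^sub>c X22 @\<^sub>c X23) = R1 X21 \<and>
         X21 * X21 = - B21 \<and> X21 * X22 = - B22 \<and> X21 * X23 = - B23 \<and>
         X31 * (X21 @\<^sub>c X22 @\<^sub>c X23) = - R3"
      using adm by blast
    \<comment> \<open>The blocks of the second and third block columns outside M do not enter the system, so
      zeros will do.\<close>
    then have "solution (?E X11 (0\<^sub>m r r) (0\<^sub>m r s) X21 X22 X23 X31 (0\<^sub>m s r) (0\<^sub>m s s))"
      using X21(2) by (subst sol) auto
    then show "\<exists>X1. solution X1" by blast
  qed
  have independence: "(\<exists>G. inner_inverse M G \<and> range_conditions (R1 X21) R3 M G) \<longleftrightarrow>
      (\<forall>G. inner_inverse M G \<longrightarrow> range_conditions (R1 X21) R3 M G)"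
    if "X21 \<in> carrier_mat r r" and M: "M \<in> carrier_mat r N" for X21 M
    using range_condition_iff_solvable[OF M R1c[OF that(1)]] range_condition_iff_solvable[OF M R3c]
      inner_inverse_exists[of M]
    unfolding range_conditions_def by blast
  have parametrization: "{X1. solution X1 \<and>
            (\<exists>X11 \<in> carrier_mat r r. \<exists>X12 \<in> carrier_mat r r. \<exists>X13 \<in> carrier_mat r s.
             \<exists>X22 \<in> carrier_mat r r. \<exists>X23 \<in> carrier_mat r s.
             \<exists>X31 \<in> carrier_mat s r. \<exists>X32 \<in> carrier_mat s r. \<exists>X33 \<in> carrier_mat s s.
               X1 = Sinv * block33 X11 X12 X13 X21 X22 X23 X31 X32 X33 * S)} =
         {Sinv * block33 X11 X12 X13 X21 X22 X23 X31 X32 X33 * S |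
            X11 X12 X13 X22 X23 X31 X32 X33 Z22 Z23 Z31 Z11 M.
            Z22 \<in> carrier_mat r r \<and> Z23 \<in> carrier_mat r s \<and>
            Z31 \<in> carrier_mat s r \<and> Z11 \<in> carrier_mat r r \<and>
            X21 * X21inv * B22 = B22 \<and> X21 * X21inv * B23 = B23 \<and>
            X22 = - X21inv * B22 + (1\<^sub>m r - X21inv * X21) * Z22 \<and>
            X23 = - X21inv * B23 + (1\<^sub>m r - X21inv * X21) * Z23 \<and>
            M = X21 @\<^sub>c X22 @\<^sub>c X23 \<and>
            range_conditions (R1 X21) R3 M (Minv M) \<and>
            X31 = - R3 * Minv M + Z31 * (1\<^sub>m r - M * Minv M) \<and>
            X11 = R1 X21 * Minv M + Z11 * (1\<^sub>m r - M * Minv M) \<and>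
            X12 \<in> carrier_mat r r \<and> X13 \<in> carrier_mat r s \<and>
            X32 \<in> carrier_mat s r \<and> X33 \<in> carrier_mat s s}" (is "?solutions = ?family")
    if admissible: "admissible r s B21 B22 B23 R1 R3 X21"
      and X21inv: "inner_inverse X21 X21inv"
      and Minv: "\<And>M. M \<in> carrier_mat r N \<Longrightarrow> inner_inverse M (Minv M)" for X21 X21inv Minv
  proof -
    have X21: "X21 \<in> carrier_mat r r" using admissible by (simp add: admissible_def)
    have square: "X21 * X21 = - B21" using admissible adm[OF X21] by blast
    note X21invc = inner_inverseD(1)[OF X21inv X21]
    have second_row: "X21 * Y = - C \<longleftrightarrow> X21 * X21inv * C = C \<and>
        (\<exists>Z \<in> carrier_mat r k. Y = - X21inv * C + (1\<^sub>m r - X21inv * X21) * Z)"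
      if "C \<in> carrier_mat r k" "Y \<in> carrier_mat r k" for C Y k
    proof -
      have "- C = X21 * X21inv * - C \<longleftrightarrow> X21 * X21inv * C = C"
        using X21 X21invc that(1) by (auto simp: eq_commute[of C])
      moreover have "X21inv * - C = - X21inv * C"
        using X21invc that(1) by simp
      moreover have "- C \<in> carrier_mat r k" using that(1) by simp
      ultimately show ?thesis
        using left_equation_solutions[OF X21 _ that(2) X21inv, of "- C"] by metis
    qed
    \<comment> \<open>The first and third block rows are right equations in M; the second one splits into left
      equations in X21 for X22 and X23.\<close>
    have outer_rows: "X11 * M = R1 X21 \<and> X31 * M = - R3 \<longleftrightarrow>
        range_conditions (R1 X21) R3 M (Minv M) \<and>
        (\<exists>Z31 \<in> carrier_mat s r. X31 = - R3 * Minv M + Z31 * (1\<^sub>m r - M * Minv M)) \<and>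
        (\<exists>Z11 \<in> carrier_mat r r. X11 = R1 X21 * Minv M + Z11 * (1\<^sub>m r - M * Minv M))"
      if M: "M \<in> carrier_mat r N" and "X11 \<in> carrier_mat r r" "X31 \<in> carrier_mat s r" for X11 X31 M
    proof -
      have R3': "- R3 \<in> carrier_mat s N" using R3c by simp
      show ?thesis
        unfolding right_equation_solutions[OF M R1c[OF X21] that(2) Minv[OF M]]
          right_equation_solutions[OF M R3' that(3) Minv[OF M]] range_conditions_def
          negated_R3[OF M Minv[OF M]]
        by auto
    qed
    show ?thesis
    proof (intro equalityI subsetI)
      fix X1 assume "X1 \<in> ?solutions"
      then obtain X11 X12 X13 X22 X23 X31 X32 X33 where
        X: "X11 \<in> carrier_mat r r" "X12 \<in> carrier_mat r r" "X13 \<in> carrier_mat r s"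
          "X22 \<in> carrier_mat r r" "X23 \<in> carrier_mat r s"
          "X31 \<in> carrier_mat s r" "X32 \<in> carrier_mat s r" "X33 \<in> carrier_mat s s"
        and X1: "X1 = ?E X11 X12 X13 X21 X22 X23 X31 X32 X33" and "solution X1"
        by blast
      then have eqs: "X21 * X22 = - B22" "X21 * X23 = - B23"
        "X11 * (X21 @\<^sub>c X22 @\<^sub>c X23) = R1 X21 \<and> X31 * (X21 @\<^sub>c X22 @\<^sub>c X23) = - R3"
        using sol[OF X(1-3) X21 X(4-8)] by auto
      then show "X1 \<in> ?family"
        using X(2,3,7,8) X1 second_row[OF B(5) X(4)] second_row[OF B(6) X(5)]
          outer_rows[OF Mc[OF X21 X(4,5)] X(1,6)]
        unfolding mem_Collect_eq by metis
    next
      fix X1 assume "X1 \<in> ?family"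
      then obtain X11 X12 X13 X22 X23 X31 X32 X33 Z22 Z23 Z31 Z11 M where
        Z: "Z22 \<in> carrier_mat r r" "Z23 \<in> carrier_mat r s"
          "Z31 \<in> carrier_mat s r" "Z11 \<in> carrier_mat r r"
        and consistent: "X21 * X21inv * B22 = B22" "X21 * X21inv * B23 = B23"
        and X22: "X22 = - X21inv * B22 + (1\<^sub>m r - X21inv * X21) * Z22"
        and X23: "X23 = - X21inv * B23 + (1\<^sub>m r - X21inv * X21) * Z23"
        and M: "M = X21 @\<^sub>c X22 @\<^sub>c X23"
        and range: "range_conditions (R1 X21) R3 M (Minv M)"
        and X31: "X31 = - R3 * Minv M + Z31 * (1\<^sub>m r - M * Minv M)"
        and X11: "X11 = R1 X21 * Minv M + Z11 * (1\<^sub>m r - M * Minv M)"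
        and free: "X12 \<in> carrier_mat r r" "X13 \<in> carrier_mat r s"
          "X32 \<in> carrier_mat s r" "X33 \<in> carrier_mat s s"
        and X1: "X1 = ?E X11 X12 X13 X21 X22 X23 X31 X32 X33"
        by blast
      have P: "1\<^sub>m r - X21inv * X21 \<in> carrier_mat r r"
        using X21 X21invc by (intro minus_carrier_mat mult_carrier_mat)
      have X22c: "X22 \<in> carrier_mat r r" and X23c: "X23 \<in> carrier_mat r s"
        unfolding X22 X23 using X21invc B(5,6) P Z(1,2)
        by (auto intro!: add_carrier_mat mult_carrier_mat[of _ r r])
      have Mcarrier: "M \<in> carrier_mat r N"
        unfolding M by (rule Mc[OF X21 X22c X23c])
      note Minvc = inner_inverseD(1)[OF Minv[OF Mcarrier] Mcarrier]
      have Q: "1\<^sub>m r - M * Minv M \<in> carrier_mat r r"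
        using Mcarrier Minvc by (intro minus_carrier_mat mult_carrier_mat)
      have X31c: "X31 \<in> carrier_mat s r"
        unfolding X31 using mult_carrier_mat[OF Z(3) Q] by (rule add_carrier_mat)
      have X11c: "X11 \<in> carrier_mat r r"
        unfolding X11 using mult_carrier_mat[OF Z(4) Q] by (rule add_carrier_mat)
      have "X21 * X22 = - B22"
        using second_row[OF B(5) X22c] consistent(1) X22 Z(1) by blast
      moreover have "X21 * X23 = - B23"
        using second_row[OF B(6) X23c] consistent(2) X23 Z(2) by blast
      moreover have "X11 * M = R1 X21 \<and> X31 * M = - R3"
        using outer_rows[OF Mcarrier X11c X31c] range X31 X11 Z(3,4) by blast
      ultimately have "solution X1"
        unfolding X1 sol[OF X11c free(1,2) X21 X22c X23c X31c free(3,4)] M using square by blast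
      then show "X1 \<in> ?solutions"
        using X1 X11c free X22c X23c X31c by blast
    qed
  qed
  show ?thesis
  proof (intro conjI ballI allI impI, goal_cases)
    case 1
    show ?case by (rule consistency)
  next
    case (2 X21 X22 X23)
    then show ?case unfolding Let_def by (intro independence Mc)
  next
    case 3
    then show ?case by (rule adm_of_solution)
  next
    case (4 X21 X21inv Minv)
    then show ?case by (intro parametrization) auto
  qed
qed

end
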